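(* Let $a,b,c,d>0$ with $ad>bc$, and let $\{W_n(z)\}_{n\ge0}$ be defined by $W_0(z)=1$, $W_1(z)=z$, $W_n(z)=(az+b)W_{n-1}(z)+(cz+d)W_{n-2}(z)$ for $n\ge2$. Let $\Delta_\Delta=-a^2d+abc+c^2$ and $x_\Delta^{\pm}=\dfrac{-ab-2c\pm2\sqrt{\Delta_\Delta}}{a^2}$. Suppose that at least one of the two numbers $(2-a)x_\Delta^+-b$ and $(2-a)x_\Delta^--b$ is a positive real number. Then there exists $N$ such that $W_n(z)$ has at least one real zero for every $n>N$.
   Context: Here $\sqrt{\Delta_\Delta}$ denotes a (possibly non-real) square root, so $x_\Delta^\pm$ are the two roots of $a^2z^2+(2ab+4c)z+b^2+4d$. *)

theory Defs
  imports Complex_Main "HOL-Computational_Algebra.Polynomial"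
begin

fun W :: "real \<Rightarrow> real \<Rightarrow> real \<Rightarrow> real \<Rightarrow> nat \<Rightarrow> real poly" where
  "W a b c d 0 = 1"
| "W a b c d (Suc 0) = [:0, 1:]"
| "W a b c d (Suc (Suc n)) = [:b, a:] * W a b c d (Suc n) + [:d, c:] * W a b c d n"

definition Delta_Delta :: "real \<Rightarrow> real \<Rightarrow> real \<Rightarrow> real \<Rightarrow> real" where
  "Delta_Delta a b c d = - (a\<^sup>2 * d) + a * b * c + c\<^sup>2"

(* The discriminant may be negative, so the square root is the complex one (principal branch);
   the other choice of branch would only swap the two values below. *)

definition x_Delta_plus :: "real \<Rightarrow> real \<Rightarrow> real \<Rightarrow> real \<Rightarrow> complex" where
  "x_Delta_plus a b c d =
     (- of_real a * of_real b - 2 * of_real c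
        + 2 * csqrt (of_real (Delta_Delta a b c d))) / (of_real a)\<^sup>2"

definition x_Delta_minus :: "real \<Rightarrow> real \<Rightarrow> real \<Rightarrow> real \<Rightarrow> complex" where
  "x_Delta_minus a b c d =
     (- of_real a * of_real b - 2 * of_real c
        - 2 * csqrt (of_real (Delta_Delta a b c d))) / (of_real a)\<^sup>2"

definition positive_real :: "complex \<Rightarrow> bool" where
  "positive_real w \<longleftrightarrow> w \<in> \<real> \<and> 0 < Re w"

end

(*
  W_n(0) >= 0 for all n, so a real zero exists as soon as W_n is negative somewhere to the left
  of 0. For odd n, W_n is negative far to the left. For even n, evaluate at the left root
  x = x_Delta_minus of the discriminant of the characteristic equation: there the
  equation has the double root h = (a x + b)/2 < 0, so h W_n(x) = h^n (h + n (x - h)),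
  where 2 (x - h) = (2 - a) x - b. If this number is positive, W_n(x) < 0 for large even n.
  The hypothesis forces real roots and a > 2, and then positivity at the right root implies
  positivity at the left one.
*)
theory Submission
  imports Defs
begin

lemma poly_W_Suc_Suc:
  "poly (W a b c d (Suc (Suc n))) x =
     (a * x + b) * poly (W a b c d (Suc n)) x + (c * x + d) * poly (W a b c d n) x"
  by (simp add: algebra_simps)

declare W.simps(3) [simp del]

lemma poly_W_0_nonneg:
  assumes "b \<ge> 0" "d \<ge> 0"
  shows "poly (W a b c d n) 0 \<ge> 0"
proof (induction n rule: induct_nat_012)
  case (ge2 n)
  then show ?case using assms by (simp add: poly_W_Suc_Suc)
qed auto

lemma poly_W_root_if_neg:
  assumes "b \<ge> 0" "d \<ge> 0" "x \<le> 0" "poly (W a b c d n) x \<le> 0"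
  shows "\<exists>z. poly (W a b c d n) z = 0"
  using IVT[of "poly (W a b c d n)" x 0 0] assms poly_W_0_nonneg[of b d a c n]
  by (auto intro: poly_isCont)

text \<open>The sign of \<open>W\<close> far to the left would give a point depending on
  \<open>n\<close>. A single point \<open>- t\<close> serves all \<open>n\<close> because the signed
  values at it stay positive and grow by a factor of at least \<open>K\<close> at each step.\<close>

lemma poly_W_alternating:
  assumes "a > 0" "b \<ge> 0" "c \<ge> 0" "d \<ge> 0"
  obtains t where "t > 0" "\<And>n. (-1) ^ n * poly (W a b c d n) (- t) > 0"
proof -
  (* K is chosen so that the growth ratio K of the signed values propagates:
     a * K - c = 1 turns the requirement into t >= K^2 + b * K - d. *)
  define K where "K = (1 + c) / a"
  define t where "t = K\<^sup>2 + b * K + K"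
  define V where "V n = (-1) ^ n * poly (W a b c d n) (- t)" for n
  have K: "K > 0" and aK: "a * K = 1 + c"
    using assms by (auto simp: K_def)
  have t: "t \<ge> K"
    using K assms by (simp add: t_def)
  have V_rec: "V (Suc (Suc n)) = (a * t - b) * V (Suc n) - (c * t - d) * V n" for n
    by (simp add: V_def poly_W_Suc_Suc algebra_simps)
  have "K * ((a * t - b) - K) - (c * t - d) = (a * K - c) * t - b * K - K\<^sup>2 + d"
    by (simp add: algebra_simps power2_eq_square)
  also have "\<dots> = K + d"
    by (simp add: aK t_def)
  finally have key: "K * ((a * t - b) - K) - (c * t - d) = K + d" .
  have step: "V (Suc (Suc n)) \<ge> K * V (Suc n)"
    if V: "V n > 0" "V (Suc n) \<ge> K * V n" for n
  \<comment> \<open>If \<open>c * t - d\<close> is nonnegative, the subtracted term is absorbed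
    using \<open>V n \<le> V (Suc n) / K\<close>. Otherwise that term only helps, and
    \<open>a * t - b \<ge> K\<close> suffices.\<close>
  proof (cases "c * t - d \<ge> 0")
    case True
    have "K * ((a * t - b) - K) \<ge> 0"
      using key True K assms(4) by linarith
    then have "(a * t - b) - K \<ge> 0"
      using K by (simp add: zero_le_mult_iff)
    then have "((a * t - b) - K) * (K * V n) \<le> ((a * t - b) - K) * V (Suc n)"
      using V(2) by (intro mult_left_mono)
    moreover have "(K * ((a * t - b) - K) - (c * t - d)) * V n \<ge> 0"
      unfolding key using K V(1) assms(4) by simp
    ultimately show ?thesis
      unfolding V_rec by (simp add: algebra_simps)
  next
    case False
    have "a * t - b \<ge> K"
    proof -
      have "a * t = (1 + c) * (K + b + 1)"
        unfolding t_def aK[symmetric] by (simp add: algebra_simps power2_eq_square)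
      also have "\<dots> \<ge> 1 * (K + b + 1)"
        using K assms by (intro mult_right_mono) auto
      finally show ?thesis by simp
    qed
    moreover have "V (Suc n) \<ge> 0"
      using V K by (smt (verit) mult_pos_pos)
    ultimately have "(a * t - b) * V (Suc n) \<ge> K * V (Suc n)"
      by (intro mult_right_mono)
    moreover have "(c * t - d) * V n \<le> 0"
      using False V(1) by (simp add: mult_nonpos_nonneg)
    ultimately show ?thesis
      unfolding V_rec by linarith
  qed
  have "V n > 0 \<and> V (Suc n) \<ge> K * V n" for n
  proof (induction n)
    case 0
    then show ?case using t by (simp add: V_def)
  next
    case (Suc n)
    then show ?case using step[of n] K by (smt (verit) mult_pos_pos)
  qed
  with t K show ?thesis
    by (intro that[of t]) (auto simp: V_def)
qed

text \<open>The assumptions say that \<open>h\<close> is a double root of the characteristic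
  equation, so the values have the form \<open>h ^ n * (A + B * n)\<close>; the initial values 1 and
  \<open>x\<close> fix \<open>A\<close> and \<open>B\<close>. The factor \<open>h\<close> on the
  left avoids a division.\<close>

lemma poly_W_double_root:
  assumes "a * x + b = 2 * h" "c * x + d = - h\<^sup>2"
  shows "h * poly (W a b c d n) x = h ^ n * (h + real n * (x - h))"
proof (induction n rule: induct_nat_012)
  case (ge2 n)
  have "h * poly (W a b c d (Suc (Suc n))) x =
      2 * h * (h * poly (W a b c d (Suc n)) x) - h\<^sup>2 * (h * poly (W a b c d n) x)"
    unfolding poly_W_Suc_Suc assms by (simp add: algebra_simps)
  also have "\<dots> = h ^ Suc (Suc n) * (h + real (Suc (Suc n)) * (x - h))"
    unfolding ge2 by (simp add: algebra_simps power2_eq_square)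
  finally show ?case .
qed auto

text \<open>The bound on \<open>n\<close> is the zero of the linear factor
  \<open>h + n * (x - h)\<close>.\<close>

lemma poly_W_even_neg:
  assumes "a * x + b = 2 * h" "c * x + d = - h\<^sup>2" "h < 0" "h < x"
    and "even n" "real n > h / (h - x)"
  shows "poly (W a b c d n) x < 0"
proof -
  have "h + real n * (x - h) > 0"
    using assms(4,6) by (simp add: field_simps)
  moreover have "h ^ n > 0"
    using assms(3,5) by (simp add: zero_less_power_eq)
  ultimately have "h * poly (W a b c d n) x > 0"
    unfolding poly_W_double_root[OF assms(1,2)] by simp
  with assms(3) show ?thesis
    by (simp add: zero_less_mult_iff)
qed

lemma discriminant_root_properties:
  assumes "a > 0" "b > 0" "c > 0" "d > 0"
    and pos: "positive_real ((2 - of_real a) * x_Delta_plus a b c d - of_real b) \<or>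
         positive_real ((2 - of_real a) * x_Delta_minus a b c d - of_real b)"
  obtains x h where "a * x + b = 2 * h" "c * x + d = - h\<^sup>2" "h < 0" "h < x" "x < 0"
proof -
  let ?D = "Delta_Delta a b c d"
  \<comment> \<open>The absolute value lets \<open>s\<close> describe the complex square root for
    either sign of \<open>?D\<close>.\<close>
  define s where "s = sqrt \<bar>?D\<bar>"
  define xp where "xp = (- a * b - 2 * c + 2 * s) / a\<^sup>2"
  define xm where "xm = (- a * b - 2 * c - 2 * s) / a\<^sup>2"
  have D: "?D \<ge> 0"
  proof (rule ccontr)
    assume neg: "\<not> ?D \<ge> 0"
    have s: "s > 0"
      using neg by (simp add: s_def)
    have sq: "csqrt (of_real ?D) = \<i> * of_real s"
      using neg by (simp add: s_def csqrt_of_real_nonpos)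
    have Im: "Im (x_Delta_plus a b c d) = 2 * s / a\<^sup>2"
      "Im (x_Delta_minus a b c d) = - (2 * s / a\<^sup>2)"
      unfolding x_Delta_plus_def x_Delta_minus_def sq of_real_power[symmetric]
      by (simp_all add: Im_divide_of_real del: of_real_power)
    \<comment> \<open>A real value forces the imaginary part, \<open>2 - a\<close> times a nonzero
      number, to vanish. But for \<open>a = 2\<close> the value is \<open>- b\<close>, which is not
      positive.\<close>
    have "a = 2"
      using pos s assms(1) Im by (auto simp: positive_real_def complex_is_Real_iff)
    with pos assms(2) show False
      by (auto simp: positive_real_def)
  qed
  have s: "s \<ge> 0" "s\<^sup>2 = ?D"
    using D by (auto simp: s_def)
  have sq: "csqrt (of_real ?D) = of_real s"
    using D by (simp add: s_def csqrt_of_real_nonneg)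
  have x: "x_Delta_plus a b c d = of_real xp" "x_Delta_minus a b c d = of_real xm"
    unfolding x_Delta_plus_def x_Delta_minus_def sq xp_def xm_def by simp_all
  have "(2 - a) * xp - b > 0 \<or> (2 - a) * xm - b > 0"
    using pos unfolding x positive_real_def by simp
  moreover have "xm \<le> xp"
    unfolding xm_def xp_def using s by (intro divide_right_mono) auto
  \<comment> \<open>This amounts to the product of the roots,
    \<open>(b\<^sup>2 + 4 * d) / a\<^sup>2\<close>, being positive; as their sum is negative, both
    roots are negative.\<close>
  moreover have "s\<^sup>2 < (a * b + 2 * c)\<^sup>2 / 4"
  proof -
    have "(a * b + 2 * c)\<^sup>2 / 4 - s\<^sup>2 = (a * b)\<^sup>2 / 4 + a\<^sup>2 * d"
      unfolding s(2) Delta_Delta_def by (simp add: field_simps power2_eq_square)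
    also have "\<dots> > 0"
      using assms by (simp add: add_pos_pos)
    finally show ?thesis by simp
  qed
  then have "(2 * s)\<^sup>2 < (a * b + 2 * c)\<^sup>2"
    by (simp add: power_mult_distrib)
  then have "2 * s < a * b + 2 * c"
    by (rule power2_less_imp_less) (use assms in simp)
  then have "xp < 0"
    unfolding xp_def using assms by (simp add: divide_less_0_iff)
  ultimately have "xm < 0" and ineq: "(2 - a) * xm - b > 0"
  proof -
    assume *: "(2 - a) * xp - b > 0 \<or> (2 - a) * xm - b > 0" "xm \<le> xp"
    from \<open>xp < 0\<close> * show xm: "xm < 0" by simp
    \<comment> \<open>Otherwise both values would be at most \<open>- b\<close>. The negative factor
      then reverses the order, so the smaller root gives the larger value.\<close>
    have "2 - a < 0"
      using * \<open>xp < 0\<close> xm assms(2) by (smt (verit) mult_nonneg_nonpos)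
    then have "(2 - a) * xp \<le> (2 - a) * xm"
      using * by (intro mult_left_mono_neg) auto
    with * show "(2 - a) * xm - b > 0" by linarith
  qed
  \<comment> \<open>Half of \<open>a * xm + b\<close>; the minus branch makes it negative.\<close>
  define h where "h = - ((c + s) / a)"
  have h: "a * xm + b = 2 * h"
    unfolding xm_def h_def using assms(1) by (simp add: field_simps power2_eq_square)
  have "a\<^sup>2 * (c * xm + d) = - (c + s)\<^sup>2 + (s\<^sup>2 - ?D)"
    unfolding xm_def Delta_Delta_def using assms(1)
    by (simp add: field_simps power2_eq_square)
  then have "c * xm + d = - h\<^sup>2"
    using s(2) assms(1) by (simp add: h_def power_divide field_simps)
  moreover have "h < 0"
    using assms s by (simp add: h_def field_simps)
  moreover have "h < xm"
    using h ineq by (simp add: algebra_simps)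
  ultimately show ?thesis
    using that h \<open>xm < 0\<close> by blast
qed

theorem theorem2p3:
  fixes a b c d :: real
  assumes "a > 0" and "b > 0" and "c > 0" and "d > 0"
    and "a * d > b * c"
    and "positive_real ((2 - of_real a) * x_Delta_plus a b c d - of_real b) \<or>
         positive_real ((2 - of_real a) * x_Delta_minus a b c d - of_real b)"
  shows "\<exists>N. \<forall>n>N. \<exists>x::real. poly (W a b c d n) x = 0"
proof -
  obtain x h where x: "a * x + b = 2 * h" "c * x + d = - h\<^sup>2" "h < 0" "h < x" "x < 0"
    using discriminant_root_properties[OF assms(1-4,6)] .
  obtain t where t: "t > 0" "\<And>n. (-1) ^ n * poly (W a b c d n) (- t) > 0"
    using poly_W_alternating[of a b c d] assms by auto
  obtain N where N: "real N > h / (h - x)"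
    using reals_Archimedean2 by blast
  have "\<exists>z. poly (W a b c d n) z = 0" if n: "n > N" for n
  proof (cases "even n")
    case True
    then have "poly (W a b c d n) x < 0"
      using n N by (intro poly_W_even_neg[OF x(1-4)]) auto
    then show ?thesis
      using poly_W_root_if_neg[of b d x a c n] assms x(5) by simp
  next
    case False
    then have "poly (W a b c d n) (- t) < 0"
      using t(2)[of n] by simp
    then show ?thesis
      using poly_W_root_if_neg[of b d "- t" a c n] assms t(1) by simp
  qed
  then show ?thesis by blast
qed

end
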